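(* Let $(\Omega,\mathcal{A},\mu)$ be a nonatomic $\sigma$-finite measure space satisfying the following condition: there is a countable family $\mathcal{A}_1\subset\mathcal{A}$ such that, for every $M\in\mathcal{A}$ with $\mu(M)<\infty$ and every $\varepsilon>0$, there exists $M_0\in\mathcal{A}_1$ with $\mu(M\,\Delta\,M_0)<\varepsilon$. Then $\left(\bigcap_{q>0}\mathcal{S}_{L_q}\right)\setminus\mathcal{S}_p$ is $\mathfrak{c}$-dense-lineable in $L_0^{\mathbb{N}}$. In particular, the sets $\mathcal{S}_m\setminus\mathcal{S}_p$, $\mathcal{S}_m\setminus\mathcal{S}_c$, $\mathcal{S}_m\setminus\mathcal{S}_{au}$ and $\mathcal{S}_m\setminus\mathcal{S}_u$ are $\mathfrak{c}$-dense-lineable in $L_0^{\mathbb{N}}$.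
   Context: $(\Omega,\mathcal{A},\mu)$ is a positive measure space with $\mu(\Omega)>0$; $A\,\Delta\,B=(A\setminus B)\cup(B\setminus A)$. It is $\sigma$-finite if $\Omega$ is a countable union of measurable sets of finite measure. An atom is a set $A\in\mathcal{A}$ with $\mu(A)>0$ for which there do not exist $B,C\in\mathcal{A}$ with $B\cap C=\varnothing$, $B\cup C=A$, $\mu(B)>0$ and $\mu(C)>0$; the measure space is nonatomic if it has no atoms. $L_0$ is the real vector space of ($\mu$-a.e. equality classes of) measurable functions $f:\Omega\to\mathbb{R}$, with the topology of local convergence in measure, i.e. the vector topology with a base of $0$-neighborhoods given by the sets $\{f\in L_0:\int_K\min\{1,|f|\}\,d\mu<\varepsilon\}$, $\varepsilon>0$, $K\in\mathcal{A}$, $\mu(K)<\infty$. $L_0^{\mathbb{N}}$ is the vector space of all sequences $(f_n)_{n\in\mathbb{N}}$ in $L_0$, with the product topology. Subsets of $L_0^{\mathbb{N}}$: $\mathcal{S}_p$: sequences with $f_n\to0$ pointwise almost everywhere. $\mathcal{S}_u$: $f_n\to0$ uniformly almost everywhere (there is $Z\in\mathcal{A}$ with $\mu(Z)=0$ and $f_n\to0$ uniformly on $\Omega\setminus Z$). $\mathcal{S}_{au}$: $f_n\to0$ almost uniformly (for every $\varepsilon>0$ there is $Z_\varepsilon\in\mathcal{A}$ with $\mu(Z_\varepsilon)<\varepsilon$ and $f_n\to0$ uniformly on $\Omega\setminus Z_\varepsilon$). $\mathcal{S}_m$: $f_n\to0$ in measure ($\lim_n\mu(\{|f_n|>\varepsilon\})=0$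 for every $\varepsilon>0$). $\mathcal{S}_{L_q}$ ($q\in(0,+\infty)$): $\lim_n\int_\Omega|f_n|^q\,d\mu=0$. $\mathcal{S}_c$: $f_n\to0$ completely ($\sum_{n=1}^\infty\mu(\{|f_n|>\varepsilon\})<\infty$ for every $\varepsilon>0$). $\mathfrak{c}$ is the cardinality of the continuum. A subset $A$ of a topological vector space $X$ is $\mathfrak{c}$-dense-lineable in $X$ if there is a dense vector subspace $V\subset X$ with $\dim(V)=\mathfrak{c}$ and $V\setminus\{0\}\subset A$. *)

theory Defs
  imports "HOL-Analysis.Analysis" "Jordan_Normal_Form.VS_Connect"
begin

section \<open>Atoms\<close>

definition atom :: "'a measure \<Rightarrow> 'a set \<Rightarrow> bool" where
  "atom M A \<longleftrightarrow> A \<in> sets M \<and> emeasure M A > 0 \<and>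
     \<not> (\<exists>B\<in>sets M. \<exists>C\<in>sets M. B \<inter> C = {} \<and> B \<union> C = A \<and> emeasure M B > 0 \<and> emeasure M C > 0)"

definition nonatomic :: "'a measure \<Rightarrow> bool" where
  "nonatomic M \<longleftrightarrow> \<not> (\<exists>A. atom M A)"


section \<open>The space of a.e. classes of measurable functions\<close>

definition ae_class :: "'a measure \<Rightarrow> ('a \<Rightarrow> real) \<Rightarrow> ('a \<Rightarrow> real) set" where
  "ae_class M f = {g \<in> borel_measurable M. AE x in M. g x = f x}"

text \<open>The type of module records extends that of rings; the fields \<open>mult\<close> and \<open>one\<close> play no
  role in the vector space structure and are left undefined.\<close>

definition L0 :: "'a measure \<Rightarrow> (real, ('a \<Rightarrow> real) set) module" where
  "L0 M = \<lparr>carrier = ae_class M ` borel_measurable M,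
     mult = undefined, one = undefined,
     zero = ae_class M (\<lambda>x. 0),
     add = (\<lambda>u v. \<Union>f\<in>u. \<Union>g\<in>v. ae_class M (\<lambda>x. f x + g x)),
     smult = (\<lambda>c u. \<Union>f\<in>u. ae_class M (\<lambda>x. c * f x))\<rparr>"

definition L0_nbhd :: "'a measure \<Rightarrow> 'a set \<Rightarrow> real \<Rightarrow> ('a \<Rightarrow> real) set set" where
  "L0_nbhd M K \<epsilon> = {ae_class M f | f. f \<in> borel_measurable M \<and>
     (\<integral>\<^sup>+x\<in>K. ennreal (min 1 \<bar>f x\<bar>) \<partial>M) < ennreal \<epsilon>}"

text \<open>The topology of local convergence in measure: the translation-invariant topology for which
  the sets \<^const>\<open>L0_nbhd\<close> form a base of neighbourhoods of zero.\<close>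

definition L0_topology :: "'a measure \<Rightarrow> ('a \<Rightarrow> real) set topology" where
  "L0_topology M = topology (\<lambda>U. U \<subseteq> carrier (L0 M) \<and>
     (\<forall>u\<in>U. \<exists>\<epsilon>>0. \<exists>K\<in>sets M. emeasure M K < \<infinity> \<and> (\<forall>w\<in>L0_nbhd M K \<epsilon>. u \<oplus>\<^bsub>L0 M\<^esub> w \<in> U)))"

definition L0_seq :: "'a measure \<Rightarrow> (real, nat \<Rightarrow> ('a \<Rightarrow> real) set) module" where
  "L0_seq M = \<lparr>carrier = {u. \<forall>n. u n \<in> carrier (L0 M)},
     mult = undefined, one = undefined,
     zero = (\<lambda>n. \<zero>\<^bsub>L0 M\<^esub>),
     add = (\<lambda>u v n. u n \<oplus>\<^bsub>L0 M\<^esub> v n),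
     smult = (\<lambda>c u n. c \<odot>\<^bsub>L0 M\<^esub> u n)\<rparr>"

definition L0_seq_topology :: "'a measure \<Rightarrow> (nat \<Rightarrow> ('a \<Rightarrow> real) set) topology" where
  "L0_seq_topology M = product_topology (\<lambda>n. L0_topology M) UNIV"

lemma ae_class_eq_iff:
  assumes "f \<in> borel_measurable M" "g \<in> borel_measurable M"
  shows "ae_class M f = ae_class M g \<longleftrightarrow> (AE x in M. f x = g x)"
proof
  assume "ae_class M f = ae_class M g"
  moreover have "f \<in> ae_class M f" using assms by (simp add: ae_class_def)
  ultimately show "AE x in M. f x = g x" by (simp add: ae_class_def)
next
  assume *: "AE x in M. f x = g x"
  have "(AE x in M. h x = f x) \<longleftrightarrow> (AE x in M. h x = g x)" for h
  proof
    assume "AE x in M. h x = f x"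
    with * show "AE x in M. h x = g x" by eventually_elim simp
  next
    assume "AE x in M. h x = g x"
    with * show "AE x in M. h x = f x" by eventually_elim simp
  qed
  then show "ae_class M f = ae_class M g" by (simp add: ae_class_def)
qed

lemma L0_zero: "\<zero>\<^bsub>L0 M\<^esub> = ae_class M (\<lambda>x. 0)"
  by (simp add: L0_def)

lemma L0_add:
  assumes "f \<in> borel_measurable M" "g \<in> borel_measurable M"
  shows "ae_class M f \<oplus>\<^bsub>L0 M\<^esub> ae_class M g = ae_class M (\<lambda>x. f x + g x)"
proof -
  have "ae_class M (\<lambda>x. f' x + g' x) = ae_class M (\<lambda>x. f x + g x)"
    if "f' \<in> ae_class M f" "g' \<in> ae_class M g" for f' g'
  proof -
    have m: "f' \<in> borel_measurable M" "g' \<in> borel_measurable M"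
      and e: "AE x in M. f' x = f x" "AE x in M. g' x = g x"
      using that by (auto simp: ae_class_def)
    have "AE x in M. f' x + g' x = f x + g x" using e by eventually_elim simp
    then show ?thesis using m assms by (subst ae_class_eq_iff) auto
  qed
  then have "(\<Union>f'\<in>ae_class M f. \<Union>g'\<in>ae_class M g. ae_class M (\<lambda>x. f' x + g' x)) =
      (\<Union>f'\<in>ae_class M f. \<Union>g'\<in>ae_class M g. ae_class M (\<lambda>x. f x + g x))"
    by (intro SUP_cong refl)
  moreover have "f \<in> ae_class M f" "g \<in> ae_class M g" using assms by (auto simp: ae_class_def)
  ultimately show ?thesis by (auto simp: L0_def)
qed

lemma L0_smult:
  assumes "f \<in> borel_measurable M"
  shows "c \<odot>\<^bsub>L0 M\<^esub> ae_class M f = ae_class M (\<lambda>x. c * f x)"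
proof -
  have "ae_class M (\<lambda>x. c * f' x) = ae_class M (\<lambda>x. c * f x)" if "f' \<in> ae_class M f" for f'
  proof -
    have m: "f' \<in> borel_measurable M" and e: "AE x in M. f' x = f x"
      using that by (auto simp: ae_class_def)
    have "AE x in M. c * f' x = c * f x" using e by eventually_elim simp
    then show ?thesis using m assms by (subst ae_class_eq_iff) auto
  qed
  then have "(\<Union>f'\<in>ae_class M f. ae_class M (\<lambda>x. c * f' x)) =
      (\<Union>f'\<in>ae_class M f. ae_class M (\<lambda>x. c * f x))"
    by (intro SUP_cong refl)
  moreover have "f \<in> ae_class M f" using assms by (auto simp: ae_class_def)
  ultimately show ?thesis by (auto simp: L0_def)
qed

lemma carrier_L0: "carrier (L0 M) = ae_class M ` borel_measurable M"
  by (simp add: L0_def)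

lemma vectorspace_L0: "vectorspace class_ring (L0 M)"
proof (rule vs_criteria)
  show "field (class_ring :: real ring)" by (rule class_field)
  show "\<forall>v\<in>carrier (L0 M). \<exists>w\<in>carrier (L0 M). v \<oplus>\<^bsub>L0 M\<^esub> w = \<zero>\<^bsub>L0 M\<^esub>"
  proof
    fix v assume "v \<in> carrier (L0 M)"
    then obtain f where f: "f \<in> borel_measurable M" "v = ae_class M f"
      by (auto simp: carrier_L0)
    show "\<exists>w\<in>carrier (L0 M). v \<oplus>\<^bsub>L0 M\<^esub> w = \<zero>\<^bsub>L0 M\<^esub>"
      by (rule bexI[of _ "ae_class M (\<lambda>x. - f x)"])
         (use f in \<open>auto simp: carrier_L0 L0_add L0_zero\<close>)
  qed
qed (auto simp: carrier_L0 L0_add L0_smult L0_zero algebra_simps)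

lemma vectorspace_L0_seq: "vectorspace class_ring (L0_seq M)"
proof -
  interpret V: vectorspace class_ring "L0 M" by (rule vectorspace_L0)
  show ?thesis
  proof (rule vs_criteria)
    show "field (class_ring :: real ring)" by (rule class_field)
    show "\<forall>v\<in>carrier (L0_seq M). \<exists>w\<in>carrier (L0_seq M). v \<oplus>\<^bsub>L0_seq M\<^esub> w = \<zero>\<^bsub>L0_seq M\<^esub>"
    proof
      fix v assume "v \<in> carrier (L0_seq M)"
      then show "\<exists>w\<in>carrier (L0_seq M). v \<oplus>\<^bsub>L0_seq M\<^esub> w = \<zero>\<^bsub>L0_seq M\<^esub>"
        by (intro bexI[of _ "\<lambda>n. \<ominus>\<^bsub>L0 M\<^esub> v n"]) (auto simp: L0_seq_def V.M.r_neg)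
    qed
  qed (auto simp: L0_seq_def V.M.a_ac V.smult_r_distr
        V.smult_l_distr[simplified] V.smult_assoc1[simplified] V.smult_one[simplified])
qed

lemma L0_nbhd_mono:
  assumes "K \<in> sets M" "K' \<in> sets M" "K \<subseteq> K'" "\<epsilon>' \<le> \<epsilon>"
  shows "L0_nbhd M K' \<epsilon>' \<subseteq> L0_nbhd M K \<epsilon>"
proof -
  have "(\<integral>\<^sup>+x\<in>K. ennreal (min 1 \<bar>f x\<bar>) \<partial>M) \<le> (\<integral>\<^sup>+x\<in>K'. ennreal (min 1 \<bar>f x\<bar>) \<partial>M)" for f
    using assms by (intro nn_integral_mono) (auto split: split_indicator)
  moreover have "ennreal \<epsilon>' \<le> ennreal \<epsilon>" using assms by (rule_tac ennreal_leI)
  ultimately show ?thesis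
    unfolding L0_nbhd_def by (blast intro: le_less_trans less_le_trans)
qed

lemma istopology_L0:
  "istopology (\<lambda>U. U \<subseteq> carrier (L0 M) \<and>
     (\<forall>u\<in>U. \<exists>\<epsilon>>0. \<exists>K\<in>sets M. emeasure M K < \<infinity> \<and> (\<forall>w\<in>L0_nbhd M K \<epsilon>. u \<oplus>\<^bsub>L0 M\<^esub> w \<in> U)))"
  (is "istopology (\<lambda>U. ?S U \<and> (\<forall>u\<in>U. ?N u U))")
  unfolding istopology_def
proof (rule conjI; intro allI impI)
  fix U V assume U: "?S U \<and> (\<forall>u\<in>U. ?N u U)" and V: "?S V \<and> (\<forall>u\<in>V. ?N u V)"
  have "?N u (U \<inter> V)" if u: "u \<in> U \<inter> V" for u
  proof -
    obtain e K where 1: "e > 0" "K \<in> sets M" "emeasure M K < \<infinity>"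
        "\<And>w. w \<in> L0_nbhd M K e \<Longrightarrow> u \<oplus>\<^bsub>L0 M\<^esub> w \<in> U"
      using U u by (meson IntD1)
    obtain d L where 2: "d > 0" "L \<in> sets M" "emeasure M L < \<infinity>"
        "\<And>w. w \<in> L0_nbhd M L d \<Longrightarrow> u \<oplus>\<^bsub>L0 M\<^esub> w \<in> V"
      using V u by (meson IntD2)
    have "L0_nbhd M (K \<union> L) (min e d) \<subseteq> L0_nbhd M K e \<inter> L0_nbhd M L d"
      using 1 2 L0_nbhd_mono[of K M "K \<union> L" "min e d" e] L0_nbhd_mono[of L M "K \<union> L" "min e d" d]
      by auto
    moreover have "emeasure M (K \<union> L) < \<infinity>"
      using 1 2 emeasure_subadditive[of K M L] by (simp add: le_less_trans)
    ultimately show ?thesis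
      using 1 2 by (intro exI[of _ "min e d"] conjI bexI[of _ "K \<union> L"]) auto
  qed
  with U V show "?S (U \<inter> V) \<and> (\<forall>u\<in>U \<inter> V. ?N u (U \<inter> V))" by blast
next
  fix \<U> assume *: "\<forall>U\<in>\<U>. ?S U \<and> (\<forall>u\<in>U. ?N u U)"
  have "?N u (\<Union>\<U>)" if u: "u \<in> U" "U \<in> \<U>" for u U
  proof -
    obtain e K where "e > 0" "K \<in> sets M" "emeasure M K < \<infinity>"
        "\<forall>w\<in>L0_nbhd M K e. u \<oplus>\<^bsub>L0 M\<^esub> w \<in> U"
      using * u by meson
    with u show ?thesis by (intro exI[of _ e] conjI bexI[of _ K]) auto
  qed
  with * show "?S (\<Union>\<U>) \<and> (\<forall>u\<in>\<Union>\<U>. ?N u (\<Union>\<U>))"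
    by blast
qed

lemma openin_L0_topology:
  "openin (L0_topology M) U \<longleftrightarrow> U \<subseteq> carrier (L0 M) \<and>
     (\<forall>u\<in>U. \<exists>\<epsilon>>0. \<exists>K\<in>sets M. emeasure M K < \<infinity> \<and> (\<forall>w\<in>L0_nbhd M K \<epsilon>. u \<oplus>\<^bsub>L0 M\<^esub> w \<in> U))"
  unfolding L0_topology_def by (subst topology_inverse'[OF istopology_L0]) (rule refl)

lemma topspace_L0_topology: "topspace (L0_topology M) = carrier (L0 M)"
proof -
  have "openin (L0_topology M) (carrier (L0 M))"
    unfolding openin_L0_topology
    by (auto intro!: exI[of _ "1::real"] bexI[of _ "{}"] simp: L0_nbhd_def carrier_L0 L0_add)
  moreover have "topspace (L0_topology M) \<subseteq> carrier (L0 M)"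
    using openin_L0_topology[of M "topspace (L0_topology M)"] by simp
  ultimately show ?thesis
    using openin_subset by blast
qed

lemma topspace_L0_seq_topology: "topspace (L0_seq_topology M) = carrier (L0_seq M)"
  by (auto simp: L0_seq_topology_def L0_seq_def topspace_L0_topology)

lemma openin_L0_nbhd:
  assumes "K \<in> sets M" "emeasure M K < \<infinity>"
  shows "openin (L0_topology M) (L0_nbhd M K \<epsilon>)"
  unfolding openin_L0_topology
proof (intro conjI ballI)
  show "L0_nbhd M K \<epsilon> \<subseteq> carrier (L0 M)" by (auto simp: L0_nbhd_def carrier_L0)
  fix u assume "u \<in> L0_nbhd M K \<epsilon>"
  then obtain f where f [measurable]: "f \<in> borel_measurable M" and u: "u = ae_class M f"
    and less: "(\<integral>\<^sup>+x\<in>K. ennreal (min 1 \<bar>f x\<bar>) \<partial>M) < ennreal \<epsilon>" (is "?I f < _")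
    by (auto simp: L0_nbhd_def)
  note [measurable] = assms(1)
  obtain a where a: "?I f = ennreal a" "a \<ge> 0"
    using less by (cases "?I f") auto
  with less have "a < \<epsilon>" by (simp add: ennreal_less_iff)
  have "u \<oplus>\<^bsub>L0 M\<^esub> w \<in> L0_nbhd M K \<epsilon>" if w': "w \<in> L0_nbhd M K (\<epsilon> - a)" for w
  proof -
    obtain g where g [measurable]: "g \<in> borel_measurable M" and w: "w = ae_class M g"
      and lg: "(\<integral>\<^sup>+x\<in>K. ennreal (min 1 \<bar>g x\<bar>) \<partial>M) < ennreal (\<epsilon> - a)"
      using w' by (auto simp: L0_nbhd_def)
    have "?I (\<lambda>x. f x + g x) \<le>
        (\<integral>\<^sup>+x. ennreal (min 1 \<bar>f x\<bar>) * indicator K x + ennreal (min 1 \<bar>g x\<bar>) * indicator K x \<partial>M)"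
      by (intro nn_integral_mono)
         (auto split: split_indicator simp flip: ennreal_plus intro!: ennreal_leI)
    also have "\<dots> = ?I f + ?I g" by (intro nn_integral_add) auto
    also have "\<dots> < ennreal a + ennreal (\<epsilon> - a)"
      using lg a by (simp add: ennreal_add_left_cancel_less)
    also have "\<dots> = ennreal \<epsilon>" using a \<open>a < \<epsilon>\<close> by (simp flip: ennreal_plus)
    finally show ?thesis by (auto simp: u w L0_add L0_nbhd_def)
  qed
  then show "\<exists>\<delta>>0. \<exists>K'\<in>sets M. emeasure M K' < \<infinity> \<and>
      (\<forall>w\<in>L0_nbhd M K' \<delta>. u \<oplus>\<^bsub>L0 M\<^esub> w \<in> L0_nbhd M K \<epsilon>)"
    using \<open>a < \<epsilon>\<close> assms by (intro exI[of _ "\<epsilon> - a"] conjI bexI[of _ K]) auto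
qed


section \<open>Modes of convergence to zero\<close>

text \<open>The sequences of classes possessing representatives with property \<open>P\<close>. The properties used
  below are invariant under modification of each term on a null set.\<close>

definition class_seqs :: "'a measure \<Rightarrow> ((nat \<Rightarrow> 'a \<Rightarrow> real) \<Rightarrow> bool) \<Rightarrow> (nat \<Rightarrow> ('a \<Rightarrow> real) set) set" where
  "class_seqs M P = {(\<lambda>n. ae_class M (f n)) | f. (\<forall>n. f n \<in> borel_measurable M) \<and> P f}"

definition S_p :: "'a measure \<Rightarrow> (nat \<Rightarrow> ('a \<Rightarrow> real) set) set" where
  "S_p M = class_seqs M (\<lambda>f. AE x in M. (\<lambda>n. f n x) \<longlonglongrightarrow> 0)"

definition S_u :: "'a measure \<Rightarrow> (nat \<Rightarrow> ('a \<Rightarrow> real) set) set" where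
  "S_u M = class_seqs M (\<lambda>f. \<exists>Z\<in>sets M. emeasure M Z = 0 \<and>
     uniform_limit (space M - Z) f (\<lambda>x. 0) sequentially)"

definition S_au :: "'a measure \<Rightarrow> (nat \<Rightarrow> ('a \<Rightarrow> real) set) set" where
  "S_au M = class_seqs M (\<lambda>f. \<forall>\<epsilon>::real. \<epsilon> > 0 \<longrightarrow> (\<exists>Z\<in>sets M. emeasure M Z < ennreal \<epsilon> \<and>
     uniform_limit (space M - Z) f (\<lambda>x. 0) sequentially))"

definition S_m :: "'a measure \<Rightarrow> (nat \<Rightarrow> ('a \<Rightarrow> real) set) set" where
  "S_m M = class_seqs M (\<lambda>f. \<forall>\<epsilon>::real. \<epsilon> > 0 \<longrightarrow>
     (\<lambda>n. emeasure M {x \<in> space M. \<bar>f n x\<bar> > \<epsilon>}) \<longlonglongrightarrow> 0)"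

definition S_L :: "'a measure \<Rightarrow> real \<Rightarrow> (nat \<Rightarrow> ('a \<Rightarrow> real) set) set" where
  "S_L M q = class_seqs M (\<lambda>f. (\<lambda>n. \<integral>\<^sup>+x. ennreal (\<bar>f n x\<bar> powr q) \<partial>M) \<longlonglongrightarrow> 0)"

definition S_c :: "'a measure \<Rightarrow> (nat \<Rightarrow> ('a \<Rightarrow> real) set) set" where
  "S_c M = class_seqs M (\<lambda>f. \<forall>\<epsilon>::real. \<epsilon> > 0 \<longrightarrow>
     (\<Sum>n. emeasure M {x \<in> space M. \<bar>f n x\<bar> > \<epsilon>}) < \<infinity>)"

lemma class_seqs_iff:
  assumes f: "\<And>n. f n \<in> borel_measurable M"
    and inv: "\<And>g. (\<And>n. g n \<in> borel_measurable M) \<Longrightarrow> AE x in M. \<forall>n. g n x = f n x \<Longrightarrow> P g \<Longrightarrow> P f"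
  shows "(\<lambda>n. ae_class M (f n)) \<in> class_seqs M P \<longleftrightarrow> P f"
proof
  assume "(\<lambda>n. ae_class M (f n)) \<in> class_seqs M P"
  then obtain g where g: "\<And>n. g n \<in> borel_measurable M" "P g"
      and eq: "(\<lambda>n. ae_class M (f n)) = (\<lambda>n. ae_class M (g n))"
    unfolding class_seqs_def by blast
  have "ae_class M (g n) = ae_class M (f n)" for n
    using fun_cong[OF eq, of n] by simp
  then have "AE x in M. \<forall>n. g n x = f n x"
    using f g(1) by (simp add: AE_all_countable ae_class_eq_iff)
  with inv g(1,2) show "P f" by blast
qed (use f in \<open>auto simp: class_seqs_def\<close>)

lemma in_S_p_iff:
  assumes "\<And>n. f n \<in> borel_measurable M"
  shows "(\<lambda>n. ae_class M (f n)) \<in> S_p M \<longleftrightarrow> (AE x in M. (\<lambda>n. f n x) \<longlonglongrightarrow> 0)"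
  unfolding S_p_def
proof (rule class_seqs_iff[OF assms])
  fix g assume "AE x in M. \<forall>n. g n x = f n x" "AE x in M. (\<lambda>n. g n x) \<longlonglongrightarrow> 0"
  then show "AE x in M. (\<lambda>n. f n x) \<longlonglongrightarrow> 0" by eventually_elim simp
qed

lemma uniform_limit_off_null:
  assumes "AE x in M. \<forall>n. g n x = f n x" "Z \<in> sets M"
    and "uniform_limit (space M - Z) g (\<lambda>x. 0::real) sequentially"
  obtains Z' where "Z' \<in> sets M" "emeasure M Z' = emeasure M Z"
    "uniform_limit (space M - Z') f (\<lambda>x. 0) sequentially"
proof -
  obtain N where N: "N \<in> null_sets M" "{x \<in> space M. \<not> (\<forall>n. g n x = f n x)} \<subseteq> N"
    using assms(1) by (auto elim!: AE_E simp: null_sets_def)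
  have "uniform_limit (space M - (Z \<union> N)) g (\<lambda>x. 0) sequentially"
    using assms(3) by (rule uniform_limit_on_subset) auto
  then have "uniform_limit (space M - (Z \<union> N)) f (\<lambda>x. 0) sequentially"
    by (rule uniform_limit_cong'[THEN iffD1, rotated -1]) (use N in auto)
  moreover have "emeasure M (Z \<union> N) = emeasure M Z"
    using assms(2) N(1) by (rule emeasure_Un_null_set)
  ultimately show ?thesis
    using that[of "Z \<union> N"] assms(2) N(1) by auto
qed

lemma in_S_u_iff:
  assumes "\<And>n. f n \<in> borel_measurable M"
  shows "(\<lambda>n. ae_class M (f n)) \<in> S_u M \<longleftrightarrow>
    (\<exists>Z\<in>sets M. emeasure M Z = 0 \<and> uniform_limit (space M - Z) f (\<lambda>x. 0) sequentially)"
  unfolding S_u_def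
proof (rule class_seqs_iff[OF assms])
  fix g assume ae: "AE x in M. \<forall>n. g n x = f n x"
    and "\<exists>Z\<in>sets M. emeasure M Z = 0 \<and> uniform_limit (space M - Z) g (\<lambda>x. 0) sequentially"
  then obtain Z where Z: "Z \<in> sets M" "emeasure M Z = 0"
      "uniform_limit (space M - Z) g (\<lambda>x. 0) sequentially"
    by blast
  obtain Z' where "Z' \<in> sets M" "emeasure M Z' = emeasure M Z"
      "uniform_limit (space M - Z') f (\<lambda>x. 0) sequentially"
    using uniform_limit_off_null[OF ae Z(1,3)] by blast
  with Z(2) show "\<exists>Z\<in>sets M. emeasure M Z = 0 \<and>
      uniform_limit (space M - Z) f (\<lambda>x. 0) sequentially"
    by (intro bexI[of _ Z']) simp_all
qed

lemma in_S_au_iff: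
  assumes "\<And>n. f n \<in> borel_measurable M"
  shows "(\<lambda>n. ae_class M (f n)) \<in> S_au M \<longleftrightarrow>
    (\<forall>\<epsilon>::real. \<epsilon> > 0 \<longrightarrow> (\<exists>Z\<in>sets M. emeasure M Z < ennreal \<epsilon> \<and>
      uniform_limit (space M - Z) f (\<lambda>x. 0) sequentially))"
  unfolding S_au_def
proof (rule class_seqs_iff[OF assms], intro allI impI)
  fix g \<epsilon> assume ae: "AE x in M. \<forall>n. g n x = f n x" and "\<epsilon> > (0::real)"
    and "\<forall>\<epsilon>::real. \<epsilon> > 0 \<longrightarrow> (\<exists>Z\<in>sets M. emeasure M Z < ennreal \<epsilon> \<and>
      uniform_limit (space M - Z) g (\<lambda>x. 0) sequentially)"
  then obtain Z where Z: "Z \<in> sets M" "emeasure M Z < ennreal \<epsilon>"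
      "uniform_limit (space M - Z) g (\<lambda>x. 0) sequentially"
    by blast
  obtain Z' where "Z' \<in> sets M" "emeasure M Z' = emeasure M Z"
      "uniform_limit (space M - Z') f (\<lambda>x. 0) sequentially"
    using uniform_limit_off_null[OF ae Z(1,3)] by blast
  with Z(2) show "\<exists>Z\<in>sets M. emeasure M Z < ennreal \<epsilon> \<and>
      uniform_limit (space M - Z) f (\<lambda>x. 0) sequentially"
    by (intro bexI[of _ Z']) simp_all
qed

lemma emeasure_level_cong:
  assumes [measurable]: "\<And>n. f n \<in> borel_measurable M" "\<And>n. g n \<in> borel_measurable M"
    and "AE x in M. \<forall>n. g n x = f n x"
  shows "emeasure M {x \<in> space M. \<bar>g n x\<bar> > \<epsilon>} = emeasure M {x \<in> space M. \<bar>f n x\<bar> > (\<epsilon>::real)}"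
proof (rule emeasure_eq_AE)
  show "AE x in M. x \<in> {x \<in> space M. \<bar>g n x\<bar> > \<epsilon>} \<longleftrightarrow> x \<in> {x \<in> space M. \<bar>f n x\<bar> > \<epsilon>}"
    using assms(3) by eventually_elim simp
qed measurable

lemma in_S_m_iff:
  assumes "\<And>n. f n \<in> borel_measurable M"
  shows "(\<lambda>n. ae_class M (f n)) \<in> S_m M \<longleftrightarrow>
    (\<forall>\<epsilon>::real. \<epsilon> > 0 \<longrightarrow> (\<lambda>n. emeasure M {x \<in> space M. \<bar>f n x\<bar> > \<epsilon>}) \<longlonglongrightarrow> 0)"
  unfolding S_m_def
proof (rule class_seqs_iff[OF assms])
  fix g assume g: "\<And>n. g n \<in> borel_measurable M" "AE x in M. \<forall>n. g n x = f n x"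
    and *: "\<forall>\<epsilon>::real. \<epsilon> > 0 \<longrightarrow> (\<lambda>n. emeasure M {x \<in> space M. \<bar>g n x\<bar> > \<epsilon>}) \<longlonglongrightarrow> 0"
  show "\<forall>\<epsilon>::real. \<epsilon> > 0 \<longrightarrow> (\<lambda>n. emeasure M {x \<in> space M. \<bar>f n x\<bar> > \<epsilon>}) \<longlonglongrightarrow> 0"
    using * unfolding emeasure_level_cong[OF assms g] .
qed

lemma in_S_c_iff:
  assumes "\<And>n. f n \<in> borel_measurable M"
  shows "(\<lambda>n. ae_class M (f n)) \<in> S_c M \<longleftrightarrow>
    (\<forall>\<epsilon>::real. \<epsilon> > 0 \<longrightarrow> (\<Sum>n. emeasure M {x \<in> space M. \<bar>f n x\<bar> > \<epsilon>}) < \<infinity>)"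
  unfolding S_c_def
proof (rule class_seqs_iff[OF assms])
  fix g assume g: "\<And>n. g n \<in> borel_measurable M" "AE x in M. \<forall>n. g n x = f n x"
    and *: "\<forall>\<epsilon>::real. \<epsilon> > 0 \<longrightarrow> (\<Sum>n. emeasure M {x \<in> space M. \<bar>g n x\<bar> > \<epsilon>}) < \<infinity>"
  show "\<forall>\<epsilon>::real. \<epsilon> > 0 \<longrightarrow> (\<Sum>n. emeasure M {x \<in> space M. \<bar>f n x\<bar> > \<epsilon>}) < \<infinity>"
    using * unfolding emeasure_level_cong[OF assms g] .
qed

lemma in_S_L_iff:
  assumes "\<And>n. f n \<in> borel_measurable M"
  shows "(\<lambda>n. ae_class M (f n)) \<in> S_L M q \<longleftrightarrow>
    (\<lambda>n. \<integral>\<^sup>+x. ennreal (\<bar>f n x\<bar> powr q) \<partial>M) \<longlonglongrightarrow> 0"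
  unfolding S_L_def
proof (rule class_seqs_iff[OF assms])
  fix g assume ae: "AE x in M. \<forall>n. g n x = f n x"
    and lim: "(\<lambda>n. \<integral>\<^sup>+x. ennreal (\<bar>g n x\<bar> powr q) \<partial>M) \<longlonglongrightarrow> 0"
  have "(\<integral>\<^sup>+x. ennreal (\<bar>g n x\<bar> powr q) \<partial>M) = (\<integral>\<^sup>+x. ennreal (\<bar>f n x\<bar> powr q) \<partial>M)" for n
    by (rule nn_integral_cong_AE) (use ae in \<open>eventually_elim, simp\<close>)
  with lim show "(\<lambda>n. \<integral>\<^sup>+x. ennreal (\<bar>f n x\<bar> powr q) \<partial>M) \<longlonglongrightarrow> 0" by simp
qed


section \<open>Dense lineability\<close>

text \<open>\<open>E\<close> is the vector space structure and \<open>T\<close> the topology of a real topological vector space.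
  The dimension of a subspace is the cardinality of its Hamel bases.\<close>

definition continuum_dense_lineable ::
    "(real, 'v) module \<Rightarrow> 'v topology \<Rightarrow> 'v set \<Rightarrow> bool" where
  "continuum_dense_lineable E T A \<longleftrightarrow>
     (\<exists>V. VectorSpace.subspace class_ring V E \<and>
          T closure_of V = topspace T \<and>
          (\<exists>B. vectorspace.basis class_ring (E\<lparr>carrier := V\<rparr>) B \<and> B \<approx> (UNIV :: real set)) \<and>
          V - {\<zero>\<^bsub>E\<^esub>} \<subseteq> A)"

end

theory Submission
  imports Defs
begin

text \<open>
  Membership in the set in question and openness in the product topology are complementary
  conditions on a sequence: the former depends only on its tail, the latter only on
  finitely many terms. So take tails \<open>w\<^sub>t\<close>, for real \<open>t\<close>, whose nonzero linear combinations tend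
  to \<open>0\<close> in every \<open>L\<^sub>q\<close> but not pointwise, and overwrite an initial segment of each \<open>w\<^sub>t\<close> so that
  every initial segment of every sequence occurs for some \<open>t\<close>; the result is at once a basis of
  size continuum and a dense set. There are enough indices \<open>t\<close>, because by separability a class
  is determined by countably many bits, namely which sets of the countable family approximate
  which truncated superlevel sets within \<open>1 / n\<close>.

  The tails are typewriter sequences. By nonatomicity a set \<open>A\<close> of finite positive measure is, for
  each \<open>k\<close>, a finite union of pieces of measure at most \<open>1 / (k + 1)\<close>; the terms of \<open>w\<^sub>t\<close> are the
  indicators of the pieces, weighted on the \<open>k\<close>-th block of pieces by the indicator of the \<open>t\<close>-th
  member of an almost disjoint family of sets of natural numbers. On infinitely many blocks a
  combination of the \<open>w\<^sub>s\<close> is its coefficient at \<open>t\<close> times an indicator, so it converges to \<open>0\<close>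
  at no point of \<open>A\<close>.
\<close>

section \<open>Dense lineability from a family indexed by the reals\<close>

lemma continuum_dense_lineable_mono:
  assumes "continuum_dense_lineable E T A" "A \<subseteq> A'"
  shows "continuum_dense_lineable E T A'"
  using assms unfolding continuum_dense_lineable_def by (meson order_trans)

text \<open>The hypothesis \<open>comb\<close> does three jobs. With \<open>zero\<close> it makes
  \<open>b\<close> injective and its range linearly independent, and it places every nonzero vector
  of the span in \<open>A\<close>. The span is dense because it contains \<open>range b\<close>, and
  injectivity gives its basis the size of the continuum.\<close>

lemma continuum_dense_lineableI:
  fixes E :: "(real, 'v) module" and b :: "real \<Rightarrow> 'v"
  assumes "vectorspace class_ring E" and top: "topspace T = carrier E"
    and b: "\<And>t. b t \<in> carrier E"
    and comb: "\<And>S c t. finite S \<Longrightarrow> t \<in> S \<Longrightarrow> c t \<noteq> 0 \<Longrightarrow> (\<Oplus>\<^bsub>E\<^esub>s\<in>S. c s \<odot>\<^bsub>E\<^esub> b s) \<in> A"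
    and zero: "\<zero>\<^bsub>E\<^esub> \<notin> A"
    and dense: "T closure_of (range b) = topspace T"
  shows "continuum_dense_lineable E T A"
proof -
  interpret V: vectorspace class_ring E by fact
  note [simp] = V.smult_closed[simplified]
  have inj: "inj b"
  proof (rule injI, rule ccontr)
    fix s t assume st: "b s = b t" "s \<noteq> t"
    \<comment> \<open>If \<open>b s = b t\<close>, then \<open>b s - b t\<close> is a zero
      combination with nonzero coefficients, against \<open>comb\<close> and
      \<open>zero\<close>.\<close>
    define c where "c r = (if r = s then 1 else -1 :: real)" for r
    have "(\<Oplus>\<^bsub>E\<^esub>r\<in>{s, t}. c r \<odot>\<^bsub>E\<^esub> b r) = c s \<odot>\<^bsub>E\<^esub> b s \<oplus>\<^bsub>E\<^esub> c t \<odot>\<^bsub>E\<^esub> b t"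
      using st(2) b by (subst V.M.finsum_insert) (auto simp: V.M.finsum_insert)
    also have "\<dots> = (c s + c t) \<odot>\<^bsub>E\<^esub> b t"
      using st(1) b by (simp add: V.smult_l_distr[simplified])
    also have "\<dots> = \<zero>\<^bsub>E\<^esub>"
      using st b V.lmult_0[of "b t"] by (simp add: c_def)
    finally show False
      using comb[of "{s, t}" s c] zero by (simp add: c_def)
  qed
  have lincomb: "V.lincomb a B \<in> A"
    if B: "finite B" "B \<subseteq> range b" and v: "v \<in> B" "a v \<noteq> 0" for a B v
  proof -
    obtain S where S: "B = b ` S" "finite S"
      using finite_subset_image[OF B] by metis
    have "V.lincomb a B = (\<Oplus>\<^bsub>E\<^esub>s\<in>S. a (b s) \<odot>\<^bsub>E\<^esub> b s)"
      unfolding V.lincomb_def S(1)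
      by (rule V.M.finsum_reindex) (use b inj in \<open>auto intro: inj_on_subset\<close>)
    moreover obtain s where "s \<in> S" "v = b s" using v S by auto
    ultimately show ?thesis using comb[of S s "\<lambda>s. a (b s)"] S v by simp
  qed
  let ?V = "V.span (range b)"
  have bE: "range b \<subseteq> carrier E" using b by auto
  have sub: "subspace class_ring ?V E" using bE by (rule V.span_is_subspace)
  have sm: "submodule class_ring ?V E" using sub by (rule V.is_module)
  have bV: "range b \<subseteq> ?V" using bE by (rule V.in_own_span)
  interpret W: vectorspace class_ring "E\<lparr>carrier := ?V\<rparr>"
    using sub by (rule V.subspace_is_vs)
  have "V.lin_indpt (range b)"
  proof
    assume "V.lin_dep (range b)"
    then obtain B a v where "finite B" "B \<subseteq> range b" "V.lincomb a B = \<zero>\<^bsub>E\<^esub>" "v \<in> B" "a v \<noteq> 0"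
      unfolding V.lin_dep_def by auto
    with lincomb[of B v a] zero show False by simp
  qed
  \<comment> \<open>Independence and span have the same meaning inside the subspace as in
    \<open>E\<close>, which \<open>span_li_not_depend\<close> transfers.\<close>
  then have "W.basis (range b)"
    unfolding W.basis_def using V.span_li_not_depend[OF bV sm] bV by simp
  moreover have "range b \<approx> (UNIV :: real set)"
    using inj by (meson eqpoll_sym inj_on_image_eqpoll_self)
  moreover have "T closure_of ?V = topspace T"
    using closure_of_mono[OF bV, of T] dense closure_of_subset_topspace[of T ?V] by auto
  moreover have "?V - {\<zero>\<^bsub>E\<^esub>} \<subseteq> A"
  proof
    fix v assume v: "v \<in> ?V - {\<zero>\<^bsub>E\<^esub>}"
    then obtain a B where B: "v = V.lincomb a B" "finite B" "B \<subseteq> range b"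
      by (auto simp: V.span_def)
    have "\<exists>w\<in>B. a w \<noteq> 0"
    proof (rule ccontr)
      assume "\<not> ?thesis"
      then have "a w \<odot>\<^bsub>E\<^esub> w = \<zero>\<^bsub>E\<^esub>" if "w \<in> B" for w
        using that V.lmult_0[of w] B(3) bE by auto
      then have "v = \<zero>\<^bsub>E\<^esub>"
        unfolding B(1) V.lincomb_def by (simp cong: V.M.finsum_cong')
      with v show False by simp
    qed
    with lincomb B show "v \<in> A" by blast
  qed
  ultimately show ?thesis
    unfolding continuum_dense_lineable_def using sub by blast
qed

section \<open>Combinations and density in the sequence space\<close>

lemma L0_seq_simps:
  "u \<in> carrier (L0_seq M) \<longleftrightarrow> (\<forall>n. u n \<in> ae_class M ` borel_measurable M)"
  "\<zero>\<^bsub>L0_seq M\<^esub> = (\<lambda>n. ae_class M (\<lambda>x. 0))"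
  by (auto simp: L0_seq_def carrier_L0 L0_zero)

text \<open>Moves combinations of classes to representatives, so that the rest of the argument can
  compute with functions.\<close>

lemma L0_seq_finsum:
  fixes F :: "'i \<Rightarrow> nat \<Rightarrow> 'a \<Rightarrow> real"
  assumes [measurable]: "\<And>t n. F t n \<in> borel_measurable M" and "finite S"
  shows "(\<Oplus>\<^bsub>L0_seq M\<^esub>t\<in>S. c t \<odot>\<^bsub>L0_seq M\<^esub> (\<lambda>n. ae_class M (F t n))) =
    (\<lambda>n. ae_class M (\<lambda>x. \<Sum>t\<in>S. c t * F t n x))"
proof -
  interpret V: vectorspace class_ring "L0_seq M" by (rule vectorspace_L0_seq)
  have smult: "c t \<odot>\<^bsub>L0_seq M\<^esub> (\<lambda>n. ae_class M (F t n)) = (\<lambda>n. ae_class M (\<lambda>x. c t * F t n x))" for t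
    by (auto simp: L0_seq_def L0_smult)
  have "(\<lambda>n. ae_class M (\<lambda>x. c t * F t n x)) \<in> carrier (L0_seq M)" for t
    by (auto simp: L0_seq_simps)
  with \<open>finite S\<close> show ?thesis
    unfolding smult
    by (induction S rule: finite_induct)
       (auto simp: L0_seq_simps V.M.finsum_insert, auto simp: L0_seq_def L0_add)
qed

text \<open>A basic open set of the product restricts only the coordinates below some
  \<open>m\<close>, so it contains every member of \<open>D\<close> that agrees with
  \<open>u\<close> there.\<close>

lemma L0_seq_dense:
  assumes "D \<subseteq> carrier (L0_seq M)"
    and ex: "\<And>u m. u \<in> carrier (L0_seq M) \<Longrightarrow> \<exists>v\<in>D. \<forall>n<m. v n = u n"
  shows "L0_seq_topology M closure_of D = topspace (L0_seq_topology M)"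
proof
  show "topspace (L0_seq_topology M) \<subseteq> L0_seq_topology M closure_of D"
  proof
    fix u assume u: "u \<in> topspace (L0_seq_topology M)"
    have "\<exists>v. v \<in> D \<and> v \<in> U" if U: "u \<in> U" "openin (L0_seq_topology M) U" for U
    proof -
      obtain W where W: "finite {n. W n \<noteq> topspace (L0_topology M)}" "u \<in> Pi\<^sub>E UNIV W" "Pi\<^sub>E UNIV W \<subseteq> U"
        using U unfolding L0_seq_topology_def openin_product_topology_alt by fastforce
      obtain m where m: "\<And>n. W n \<noteq> topspace (L0_topology M) \<Longrightarrow> n < m"
        using W(1) by (auto simp: finite_nat_set_iff_bounded)
      obtain v where v: "v \<in> D" "\<And>n. n < m \<Longrightarrow> v n = u n"
        using ex[of u m] u by (auto simp: topspace_L0_seq_topology)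
      have "v n \<in> W n" for n
      proof (cases "n < m")
        case True
        with v(2) W(2) show ?thesis by auto
      next
        case False
        then have "W n = topspace (L0_topology M)" using m by blast
        with v(1) assms(1) show ?thesis by (auto simp: topspace_L0_topology L0_seq_def)
      qed
      with v(1) W(3) show ?thesis by auto
    qed
    with u show "u \<in> L0_seq_topology M closure_of D"
      by (auto simp: in_closure_of)
  qed
qed (rule closure_of_subset_topspace)

section \<open>Comparison of the modes of convergence\<close>

lemma class_seqs_mono:
  assumes "\<And>f. (\<And>n. f n \<in> borel_measurable M) \<Longrightarrow> P f \<Longrightarrow> Q f"
  shows "class_seqs M P \<subseteq> class_seqs M Q"
  using assms unfolding class_seqs_def by blast

lemma S_u_subset_S_au: "S_u M \<subseteq> S_au M"
  unfolding S_u_def S_au_def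
  by (rule class_seqs_mono) (metis ennreal_less_zero_iff)

text \<open>Exceptional sets \<open>Z k\<close> of measure below \<open>1 / Suc k\<close> have a
  null intersection, and a point outside it avoids some \<open>Z k\<close>, off which the
  convergence is uniform.\<close>

lemma S_au_subset_S_p: "S_au M \<subseteq> S_p M"
  unfolding S_au_def S_p_def
proof (rule class_seqs_mono)
  fix f :: "nat \<Rightarrow> 'a \<Rightarrow> real"
  assume "\<forall>\<epsilon>::real. \<epsilon> > 0 \<longrightarrow> (\<exists>Z\<in>sets M. emeasure M Z < ennreal \<epsilon> \<and>
      uniform_limit (space M - Z) f (\<lambda>x. 0) sequentially)"
  then have "\<forall>k. \<exists>Z. Z \<in> sets M \<and> emeasure M Z < ennreal (1 / Suc k) \<and>
      uniform_limit (space M - Z) f (\<lambda>x. 0) sequentially"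
    by (simp add: Bex_def)
  then obtain Z where Z: "\<And>k. Z k \<in> sets M" "\<And>k. emeasure M (Z k) < ennreal (1 / Suc k)"
    "\<And>k. uniform_limit (space M - Z k) f (\<lambda>x. 0) sequentially"
    by metis
  have "emeasure M (\<Inter>k. Z k) \<le> ennreal \<epsilon>" if "\<epsilon> > 0" for \<epsilon>
  proof -
    obtain k where "1 / Suc k < \<epsilon>" using \<open>\<epsilon> > 0\<close> nat_approx_posE by blast
    have "emeasure M (\<Inter>k. Z k) \<le> emeasure M (Z k)"
      using Z(1) by (intro emeasure_mono) auto
    also have "\<dots> \<le> ennreal \<epsilon>"
      using Z(2)[of k] \<open>1 / Suc k < \<epsilon>\<close> by (meson ennreal_leI less_imp_le order_trans)
    finally show ?thesis .
  qed
  then have "emeasure M (\<Inter>k. Z k) = 0"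
    using ennreal_le_epsilon[of 0 "emeasure M (\<Inter>k. Z k)"] by simp
  moreover have "(\<Inter>k. Z k) \<in> sets M" using Z(1) by auto
  ultimately have "AE x in M. x \<notin> (\<Inter>k. Z k)"
    by (intro AE_not_in) auto
  with AE_space show "AE x in M. (\<lambda>n. f n x) \<longlonglongrightarrow> 0"
  proof eventually_elim
    case (elim x)
    then obtain k where "x \<in> space M - Z k" by auto
    with Z(3) show ?case by (rule tendsto_uniform_limitI)
  qed
qed

text \<open>Borel-Cantelli at each threshold \<open>1 / Suc k\<close>: almost every point lies in
  only finitely many of the superlevel sets. Countably many thresholds suffice for convergence to
  0.\<close>

lemma S_c_subset_S_p: "S_c M \<subseteq> S_p M"
  unfolding S_c_def S_p_def
proof (rule class_seqs_mono)
  fix f :: "nat \<Rightarrow> 'a \<Rightarrow> real"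
  assume [measurable]: "\<And>n. f n \<in> borel_measurable M"
    and sum: "\<forall>\<epsilon>::real. \<epsilon> > 0 \<longrightarrow> (\<Sum>n. emeasure M {x \<in> space M. \<bar>f n x\<bar> > \<epsilon>}) < \<infinity>"
  have "AE x in M. \<forall>\<^sub>F n in sequentially. x \<in> space M - {x \<in> space M. \<bar>f n x\<bar> > 1 / Suc k}" for k
  proof (rule borel_cantelli_AE1)
    let ?A = "\<lambda>n. {x \<in> space M. \<bar>f n x\<bar> > 1 / Suc k}"
    have fin: "(\<Sum>n. emeasure M (?A n)) < \<infinity>" using sum by simp
    show *: "emeasure M (?A n) < \<infinity>" for n
      using ennreal_suminf_lessD[OF fin] by simp
    have "(\<Sum>n. ennreal (measure M (?A n))) \<noteq> \<infinity>"
      using fin * by (simp add: emeasure_eq_ennreal_measure less_top[symmetric])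
    then show "summable (\<lambda>n. measure M (?A n))"
      by (intro summable_suminf_not_top) auto
  qed measurable
  then have "AE x in M. \<forall>k. \<forall>\<^sub>F n in sequentially. x \<in> space M - {x \<in> space M. \<bar>f n x\<bar> > 1 / Suc k}"
    by (simp add: AE_all_countable)
  then show "AE x in M. (\<lambda>n. f n x) \<longlonglongrightarrow> 0"
  proof eventually_elim
    case (elim x)
    show ?case
    proof (rule tendstoI)
      fix e :: real assume "e > 0"
      then obtain k where "1 / Suc k < e" using nat_approx_posE by blast
      with elim[rule_format, of k] show "\<forall>\<^sub>F n in sequentially. dist (f n x) 0 < e"
        by (auto elim: eventually_mono)
    qed
  qed
qed

text \<open>Markov's inequality for the \<open>q\<close>-th power of the absolute value, with
  constant \<open>?c\<close>.\<close>

lemma S_L_subset_S_m: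
  assumes "q > 0"
  shows "S_L M q \<subseteq> S_m M"
  unfolding S_L_def S_m_def
proof (rule class_seqs_mono, intro allI impI)
  fix f :: "nat \<Rightarrow> 'a \<Rightarrow> real" and \<epsilon> :: real
  assume [measurable]: "\<And>n. f n \<in> borel_measurable M" and "\<epsilon> > 0"
    and lim: "(\<lambda>n. \<integral>\<^sup>+x. ennreal (\<bar>f n x\<bar> powr q) \<partial>M) \<longlonglongrightarrow> 0"
  let ?c = "ennreal (1 / \<epsilon> powr q)"
  have *: "1 \<le> ?c * ennreal (\<bar>y\<bar> powr q)" if "\<bar>y\<bar> > \<epsilon>" for y
  proof -
    have "\<epsilon> powr q \<le> \<bar>y\<bar> powr q" using that assms \<open>\<epsilon> > 0\<close> by (intro powr_mono2) auto
    then have "1 \<le> 1 / \<epsilon> powr q * \<bar>y\<bar> powr q" using \<open>\<epsilon> > 0\<close> by (simp add: field_simps)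
    then show ?thesis by (simp flip: ennreal_mult' add: ennreal_ge_1)
  qed
  have bound: "emeasure M {x \<in> space M. \<bar>f n x\<bar> > \<epsilon>} \<le> ?c * (\<integral>\<^sup>+x. ennreal (\<bar>f n x\<bar> powr q) \<partial>M)" for n
  proof -
    have "emeasure M {x \<in> space M. \<bar>f n x\<bar> > \<epsilon>} \<le>
        emeasure M {x \<in> space M. 1 \<le> ?c * ennreal (\<bar>f n x\<bar> powr q)}"
      using * by (intro emeasure_mono) auto
    also have "\<dots> \<le> ?c * (\<integral>\<^sup>+x. ennreal (\<bar>f n x\<bar> powr q) * indicator (space M) x \<partial>M)"
      by (rule nn_integral_Markov_inequality) auto
    also have "(\<integral>\<^sup>+x. ennreal (\<bar>f n x\<bar> powr q) * indicator (space M) x \<partial>M) =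
        (\<integral>\<^sup>+x. ennreal (\<bar>f n x\<bar> powr q) \<partial>M)"
      by (intro nn_integral_cong) auto
    finally show ?thesis .
  qed
  have lim': "(\<lambda>n. ?c * (\<integral>\<^sup>+x. ennreal (\<bar>f n x\<bar> powr q) \<partial>M)) \<longlonglongrightarrow> ?c * 0"
    using lim by (intro ennreal_tendsto_cmult) auto
  show "(\<lambda>n. emeasure M {x \<in> space M. \<bar>f n x\<bar> > \<epsilon>}) \<longlonglongrightarrow> 0"
    by (rule tendsto_sandwich[OF _ _ tendsto_const lim'[simplified]]) (use bound in auto)
qed

section \<open>Cutting sets into small pieces\<close>

text \<open>A set that is not an atom splits into two parts of positive measure, one of which has at
  most half of the total. Halving is iterated until the measure is below \<epsilon>.\<close>

lemma nonatomic_small_subset: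
  assumes "nonatomic M" and A: "A \<in> fmeasurable M" "measure M A > 0" and "\<epsilon> > 0"
  shows "\<exists>B\<in>fmeasurable M. B \<subseteq> A \<and> 0 < measure M B \<and> measure M B < \<epsilon>"
proof -
  have halve: "\<exists>C\<in>fmeasurable M. C \<subseteq> B \<and> 0 < measure M C \<and> measure M C \<le> measure M B / 2"
    if B: "B \<in> fmeasurable M" "measure M B > 0" for B
  proof -
    have "B \<in> sets M" "emeasure M B > 0"
      using B by (auto simp: emeasure_eq_measure2)
    then obtain C D where CD: "C \<in> sets M" "D \<in> sets M" "C \<inter> D = {}" "C \<union> D = B"
      "emeasure M C > 0" "emeasure M D > 0"
      using \<open>nonatomic M\<close> unfolding nonatomic_def atom_def by blast
    then have f: "C \<in> fmeasurable M" "D \<in> fmeasurable M"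
      using B(1) by (auto intro: fmeasurableI2[OF B(1)])
    then have "measure M B = measure M C + measure M D"
      unfolding CD(4)[symmetric] using CD(3) f by (intro measure_Un_AE AE_I2) auto
    moreover have "measure M C > 0" "measure M D > 0"
      using CD f by (auto simp: emeasure_eq_measure2)
    ultimately have "measure M C \<le> measure M B / 2 \<or> measure M D \<le> measure M B / 2"
      by linarith
    with f CD \<open>measure M C > 0\<close> \<open>measure M D > 0\<close> show ?thesis by blast
  qed
  have "\<exists>B\<in>fmeasurable M. B \<subseteq> A \<and> 0 < measure M B \<and> measure M B \<le> measure M A / 2 ^ n" for n
  proof (induction n)
    case 0
    with A show ?case by (intro bexI[of _ A]) auto
  next
    case (Suc n)
    then obtain B where B: "B \<in> fmeasurable M" "B \<subseteq> A" "0 < measure M B"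
      "measure M B \<le> measure M A / 2 ^ n" by blast
    then obtain C where "C \<in> fmeasurable M" "C \<subseteq> B" "0 < measure M C" "measure M C \<le> measure M B / 2"
      using halve by blast
    moreover have "measure M B / 2 \<le> measure M A / 2 ^ Suc n" using B(4) by simp
    ultimately show ?case using B by (intro bexI[of _ C]) auto
  qed
  moreover obtain n where "measure M A / \<epsilon> < 2 ^ n"
    using real_arch_pow[of 2 "measure M A / \<epsilon>"] by auto
  then have "measure M A / 2 ^ n < \<epsilon>" using \<open>\<epsilon> > 0\<close> by (simp add: field_simps)
  ultimately show ?thesis by (meson order.strict_trans1)
qed

text \<open>An exhaustion argument. Finite unions of small subsets of \<open>A\<close> come
  arbitrarily close to the supremum \<open>s\<close> of their measures, and what a maximizing
  sequence misses is null. Hence finitely many of its members leave a remainder small enough to be a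
  piece itself. The pieces may overlap.\<close>

lemma nonatomic_finite_cover:
  assumes "nonatomic M" and A: "A \<in> fmeasurable M" and "\<epsilon> > 0"
  shows "\<exists>F. finite F \<and> F \<subseteq> fmeasurable M \<and> (\<forall>B\<in>F. measure M B \<le> \<epsilon>) \<and> \<Union>F = A"
proof -
  define \<G> where "\<G> = {\<Union>F | F. finite F \<and> F \<subseteq> fmeasurable M \<and> (\<forall>B\<in>F. measure M B \<le> \<epsilon> \<and> B \<subseteq> A)}"
  have fm: "G \<in> fmeasurable M" and sub: "G \<subseteq> A" if "G \<in> \<G>" for G
    using that unfolding \<G>_def by (auto intro!: fmeasurable.finite_Union)
  have empty: "{} \<in> \<G>" unfolding \<G>_def by (auto intro!: exI[of _ "{}"])
  have single: "B \<in> \<G>" if "B \<in> fmeasurable M" "B \<subseteq> A" "measure M B \<le> \<epsilon>" for B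
    using that unfolding \<G>_def by (auto intro!: exI[of _ "{B}"])
  have Un: "G \<union> H \<in> \<G>" if G: "G \<in> \<G>" and H: "H \<in> \<G>" for G H
  proof -
    from G obtain F1 where F1: "G = \<Union>F1" "finite F1" "F1 \<subseteq> fmeasurable M"
        "\<forall>B\<in>F1. measure M B \<le> \<epsilon> \<and> B \<subseteq> A"
      unfolding \<G>_def by auto
    from H obtain F2 where F2: "H = \<Union>F2" "finite F2" "F2 \<subseteq> fmeasurable M"
        "\<forall>B\<in>F2. measure M B \<le> \<epsilon> \<and> B \<subseteq> A"
      unfolding \<G>_def by auto
    have "G \<union> H = \<Union>(F1 \<union> F2)" unfolding F1(1) F2(1) by simp
    moreover have "finite (F1 \<union> F2)" "F1 \<union> F2 \<subseteq> fmeasurable M"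
        "\<forall>B\<in>F1 \<union> F2. measure M B \<le> \<epsilon> \<and> B \<subseteq> A"
      using F1 F2 by auto
    ultimately show ?thesis unfolding \<G>_def mem_Collect_eq by (intro exI conjI)
  qed
  define s where "s = (SUP G\<in>\<G>. measure M G)"
  have bdd: "bdd_above (measure M ` \<G>)"
    using fm sub A by (intro bdd_aboveI2[of _ _ "measure M A"] measure_mono_fmeasurable) auto
  have le_s: "measure M G \<le> s" if "G \<in> \<G>" for G
    unfolding s_def using that bdd by (rule cSUP_upper)
  have "\<exists>G\<in>\<G>. s - 1 / Suc n < measure M G" for n
    using less_cSUP_iff[of \<G> "measure M" "s - 1 / Suc n"] bdd empty by (auto simp: s_def)
  then obtain G where G: "\<And>n. G n \<in> \<G>" "\<And>n. s - 1 / Suc n < measure M (G n)"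
    by metis
  define R where "R = A - (\<Union>n. G n)"
  have R: "R \<in> fmeasurable M" unfolding R_def using A G(1) fm by (intro fmeasurable_Diff) auto
  have "measure M R = 0"
  proof (rule ccontr)
    assume "measure M R \<noteq> 0"
    then have "measure M R > 0" by (simp add: zero_less_measure_iff)
    then obtain B where B: "B \<in> fmeasurable M" "B \<subseteq> R" "0 < measure M B" "measure M B < \<epsilon>"
      using nonatomic_small_subset[OF assms(1) R _ \<open>\<epsilon> > 0\<close>] by blast
    \<comment> \<open>\<open>G n\<close> falls short of \<open>s\<close> by less than the measure of
      \<open>B\<close>, so adding the disjoint set \<open>B\<close> would exceed
      \<open>s\<close>.\<close>
    obtain n where n: "1 / Suc n < measure M B" using B(3) nat_approx_posE by blast
    have "B \<subseteq> A" "G n \<inter> B = {}" using B(2) by (auto simp: R_def)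
    then have "measure M (G n \<union> B) = measure M (G n) + measure M B"
      using fm[OF G(1)] B by (intro measure_Un_AE AE_I2) auto
    moreover have "measure M (G n \<union> B) \<le> s"
      using B \<open>B \<subseteq> A\<close> by (intro le_s Un G single) auto
    ultimately show False using n G(2)[of n] by linarith
  qed
  \<comment> \<open>Partial unions stay in \<open>\<G>\<close> and make the remainders decreasing,
    as continuity from above requires.\<close>
  define U where "U n = (\<Union>i\<le>n. G i)" for n
  have U: "U n \<in> \<G>" for n
  proof (induction n)
    case (Suc n)
    have "U (Suc n) = U n \<union> G (Suc n)" by (auto simp: U_def atMost_Suc)
    with Suc Un G(1) show ?case by simp
  qed (simp add: U_def G)
  have "(\<lambda>n. measure M (A - U n)) \<longlonglongrightarrow> measure M (\<Inter>n. A - U n)"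
  proof (rule Lim_measure_decseq)
    show "range (\<lambda>n. A - U n) \<subseteq> sets M" using A fm[OF U] by auto
    show "decseq (\<lambda>n. A - U n)" by (auto simp: decseq_def U_def)
    show "emeasure M (A - U n) \<noteq> \<infinity>" for n
      using A fm[OF U, of n] by (metis fmeasurable.Diff fmeasurableD2 infinity_ennreal_def)
  qed
  moreover have "(\<Inter>n. A - U n) = R" by (auto simp: R_def U_def)
  ultimately have "(\<lambda>n. measure M (A - U n)) \<longlonglongrightarrow> 0" using \<open>measure M R = 0\<close> by simp
  then have "\<forall>\<^sub>F n in sequentially. measure M (A - U n) < \<epsilon>"
    using \<open>\<epsilon> > 0\<close> by (rule order_tendstoD)
  then obtain n where "measure M (A - U n) < \<epsilon>"
    by (auto simp: eventually_sequentially)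
  \<comment> \<open>The remainder serves as the last piece.\<close>
  then have "U n \<union> (A - U n) \<in> \<G>"
    using A fm[OF U] by (intro Un U single) auto
  moreover have "U n \<union> (A - U n) = A" using sub[OF U] by auto
  ultimately have "A \<in> \<G>" by simp
  then obtain F where "A = \<Union>F" "finite F" "F \<subseteq> fmeasurable M" "\<forall>B\<in>F. measure M B \<le> \<epsilon> \<and> B \<subseteq> A"
    unfolding \<G>_def by auto
  then show ?thesis by (intro exI[of _ F]) simp
qed

text \<open>Each finite cover is padded with empty sets to a sequence, so that all pieces are
  indexed by pairs and can be listed through \<open>prod_decode\<close>.\<close>

lemma nonatomic_small_pieces:
  assumes "nonatomic M" and A: "A \<in> fmeasurable M"
  obtains P :: "nat \<Rightarrow> nat \<Rightarrow> 'a set" where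
    "\<And>k i. P k i \<in> sets M" "\<And>k i. emeasure M (P k i) \<le> ennreal (1 / Suc k)"
    "\<And>k. finite {i. P k i \<noteq> {}}" "\<And>k. (\<Union>i. P k i) = A"
proof -
  have "\<exists>Q::nat \<Rightarrow> 'a set. (\<forall>i. Q i \<in> sets M \<and> emeasure M (Q i) \<le> ennreal (1 / Suc k)) \<and>
      finite {i. Q i \<noteq> {}} \<and> (\<Union>i. Q i) = A" for k
  proof -
    obtain F where F: "finite F" "F \<subseteq> fmeasurable M" "\<And>B. B \<in> F \<Longrightarrow> measure M B \<le> 1 / Suc k" "\<Union>F = A"
      using nonatomic_finite_cover[OF assms, of "1 / Suc k"] by auto
    obtain xs where xs: "set xs = F" using finite_list[OF F(1)] by blast
    define Q where "Q i = (if i < length xs then xs ! i else {})" for i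
    have Q: "Q i \<in> F \<or> Q i = {}" for i using xs by (auto simp: Q_def)
    have 1: "Q i \<in> sets M \<and> emeasure M (Q i) \<le> ennreal (1 / Suc k)" for i
      using Q[of i] F(2,3) by (auto simp: emeasure_eq_measure2 subset_iff intro!: ennreal_leI)
    have 2: "finite {i. Q i \<noteq> {}}"
      by (rule finite_subset[of _ "{..<length xs}"]) (auto simp: Q_def split: if_splits)
    have 3: "(\<Union>i. Q i) = A"
      unfolding F(4)[symmetric] xs[symmetric] by (fastforce simp: Q_def in_set_conv_nth split: if_splits)
    show ?thesis by (rule exI[of _ Q]) (use 1 2 3 in auto)
  qed
  then have "\<forall>k. \<exists>Q::nat \<Rightarrow> 'a set. (\<forall>i. Q i \<in> sets M \<and> emeasure M (Q i) \<le> ennreal (1 / Suc k)) \<and>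
      finite {i. Q i \<noteq> {}} \<and> (\<Union>i. Q i) = A" ..
  from choice[OF this] obtain P :: "nat \<Rightarrow> nat \<Rightarrow> 'a set"
    where "\<forall>k. (\<forall>i. P k i \<in> sets M \<and> emeasure M (P k i) \<le> ennreal (1 / Suc k)) \<and>
      finite {i. P k i \<noteq> {}} \<and> (\<Union>i. P k i) = A" by blast
  then show thesis by (intro that[of P]) blast+
qed

section \<open>An almost disjoint family indexed by the reals\<close>

text \<open>The indicator of the branch \<open>{(j, \<lfloor>j t\<rfloor>) | j}\<close>, coded into the natural numbers. The branches
  of distinct \<open>t\<close> share only finitely many nodes.\<close>

definition floor_branch :: "real \<Rightarrow> nat \<Rightarrow> real" where
  "floor_branch t k = (case from_nat k :: nat \<times> int of (j, z) \<Rightarrow> of_bool (z = \<lfloor>real j * t\<rfloor>))"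

lemma floor_branch_range: "0 \<le> floor_branch t k" "floor_branch t k \<le> 1"
  by (auto simp: floor_branch_def split: prod.split)

text \<open>Far enough along the branch of \<open>t\<close>, no node lies on the branch of any other
  \<open>s\<close> in the finite set \<open>S\<close>. Distinct \<open>j\<close> give distinct codes
  \<open>\<kappa> j\<close>, hence infinitely many such \<open>k\<close>.\<close>

lemma floor_branch_separate:
  assumes "finite S"
  shows "\<exists>\<^sub>\<infinity>k. \<forall>s\<in>S. floor_branch s k = of_bool (s = t)"
proof -
  define \<kappa> where "\<kappa> j = to_nat (j, \<lfloor>real j * t\<rfloor>)" for j
  have "\<forall>\<^sub>F j in sequentially. floor_branch s (\<kappa> j) = of_bool (s = t)" for s
  proof (cases "s = t")
    case False
    \<comment> \<open>From \<open>J\<close> on, \<open>j * s\<close> and \<open>j * t\<close> are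
      more than 1 apart and cannot share a floor.\<close>
    obtain J :: nat where J: "1 / \<bar>s - t\<bar> < real J" using reals_Archimedean2 by blast
    have "\<lfloor>real j * t\<rfloor> \<noteq> \<lfloor>real j * s\<rfloor>" if "j \<ge> J" for j
    proof
      assume "\<lfloor>real j * t\<rfloor> = \<lfloor>real j * s\<rfloor>"
      then have "\<bar>real j * s - real j * t\<bar> < 1" by linarith
      moreover have "real j * \<bar>s - t\<bar> = \<bar>real j * s - real j * t\<bar>"
        by (simp add: abs_mult flip: right_diff_distrib)
      moreover have "1 < real J * \<bar>s - t\<bar>" using J False by (simp add: field_simps)
      moreover have "real J * \<bar>s - t\<bar> \<le> real j * \<bar>s - t\<bar>"
        using that by (intro mult_right_mono) auto
      ultimately show False by linarith
    qed
    with False show ?thesis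
      unfolding eventually_sequentially by (auto simp: floor_branch_def \<kappa>_def intro!: exI[of _ J])
  qed (simp add: floor_branch_def \<kappa>_def)
  then have "\<forall>\<^sub>F j in sequentially. \<forall>s\<in>S. floor_branch s (\<kappa> j) = of_bool (s = t)"
    using assms by (simp add: eventually_ball_finite)
  then obtain J where J: "\<And>j s. j \<ge> J \<Longrightarrow> s \<in> S \<Longrightarrow> floor_branch s (\<kappa> j) = of_bool (s = t)"
    unfolding eventually_sequentially by blast
  have "inj \<kappa>" by (auto simp: inj_def \<kappa>_def)
  then have "infinite (\<kappa> ` {J..})"
    using infinite_Ici by (metis finite_imageD inj_on_subset subset_UNIV)
  then show ?thesis
    unfolding INFM_iff_infinite by (rule infinite_super[rotated]) (use J in auto)
qed

section \<open>Typewriter sequences\<close>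

text \<open>Late blocks contain only small pieces and the early blocks only finitely many nonempty
  ones. As \<open>sequentially\<close> is the cofinite filter, the order in which
  \<open>prod_decode\<close> lists the pieces is immaterial.\<close>

lemma small_pieces_tendsto_0:
  fixes P :: "nat \<Rightarrow> nat \<Rightarrow> 'a set"
  assumes "\<And>k i. emeasure M (P k i) \<le> ennreal (1 / Suc k)" "\<And>k. finite {i. P k i \<noteq> {}}"
  shows "(\<lambda>n. emeasure M (case_prod P (prod_decode n))) \<longlonglongrightarrow> 0"
proof (rule order_tendstoI)
  fix a :: ennreal assume "0 < a"
  \<comment> \<open>Passing to \<open>b\<close> below \<open>a\<close> gives a real threshold
    \<open>r\<close> even when \<open>a\<close> is infinite.\<close>
  then obtain b where "0 < b" "b < a" using dense by blast
  then obtain r where r: "0 < ennreal r" "ennreal r < a" by (cases b) auto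
  then obtain K where K: "1 / Suc K < r" using nat_approx_posE by (metis ennreal_less_zero_iff)
  let ?D = "SIGMA k:{..K}. {i. P k i \<noteq> {}}"
  have "finite (prod_encode ` ?D)" using assms(2) by auto
  moreover have "{n. \<not> emeasure M (case_prod P (prod_decode n)) < a} \<subseteq> prod_encode ` ?D"
  proof
    fix n assume n: "n \<in> {n. \<not> emeasure M (case_prod P (prod_decode n)) < a}"
    obtain k i where ki: "prod_decode n = (k, i)" by fastforce
    have "P k i \<noteq> {}" using n \<open>0 < a\<close> ki by auto
    moreover have "k \<le> K"
    proof (rule ccontr)
      assume "\<not> k \<le> K"
      then have "1 / Suc k \<le> 1 / Suc K" by (intro divide_left_mono) auto
      then have "ennreal (1 / Suc k) \<le> ennreal r" using K by (intro ennreal_leI) linarith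
      with assms(1)[of k i] r(2) have "emeasure M (P k i) < a" by (meson le_less_trans order_trans)
      with n ki show False by simp
    qed
    moreover have "n = prod_encode (k, i)" using ki by (metis prod_decode_inverse)
    ultimately show "n \<in> prod_encode ` ?D" by auto
  qed
  ultimately show "\<forall>\<^sub>F n in sequentially. emeasure M (case_prod P (prod_decode n)) < a"
    unfolding cofinite_eq_sequentially[symmetric] eventually_cofinite by (rule finite_subset[rotated])
qed simp

text \<open>Every block covers \<open>x\<close>, so each \<open>k\<close> with
  \<open>G k = c\<close> yields an index where the value is exactly \<open>c\<close>, and different
  \<open>k\<close> yield different indices.\<close>

lemma blocks_not_tendsto_0:
  fixes P :: "nat \<Rightarrow> nat \<Rightarrow> 'a set" and G :: "nat \<Rightarrow> real"
  assumes "\<exists>\<^sub>\<infinity>k. G k = c" "c \<noteq> 0" and x: "\<And>k. x \<in> (\<Union>i. P k i)"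
  shows "\<not> (\<lambda>n. G (fst (prod_decode n)) * indicator (case_prod P (prod_decode n)) x) \<longlonglongrightarrow> 0"
proof
  let ?f = "\<lambda>n. G (fst (prod_decode n)) * indicator (case_prod P (prod_decode n)) x"
  assume "?f \<longlonglongrightarrow> 0"
  then have "\<forall>\<^sub>F n in sequentially. \<bar>?f n\<bar> < \<bar>c\<bar>"
    using \<open>c \<noteq> 0\<close> tendstoD[of ?f 0 sequentially "\<bar>c\<bar>"] by (simp add: dist_real_def)
  then have fin: "finite {n. \<not> \<bar>?f n\<bar> < \<bar>c\<bar>}"
    unfolding cofinite_eq_sequentially[symmetric] eventually_cofinite .
  have "\<forall>k. \<exists>i. x \<in> P k i" using x by simp
  from choice[OF this] obtain i where i: "\<And>k. x \<in> P k (i k)" by blast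
  have "inj (\<lambda>k. prod_encode (k, i k))" by (auto simp: inj_def)
  then have "infinite ((\<lambda>k. prod_encode (k, i k)) ` {k. G k = c})"
    using assms(1) unfolding INFM_iff_infinite by (metis finite_imageD inj_on_subset subset_UNIV)
  moreover have "(\<lambda>k. prod_encode (k, i k)) ` {k. G k = c} \<subseteq> {n. \<not> \<bar>?f n\<bar> < \<bar>c\<bar>}"
    using i by auto
  ultimately show False using fin finite_subset by blast
qed

section \<open>Counting sequences of classes\<close>

text \<open>Two sets with the same approximants at every tolerance differ by a null set, by the
  triangle inequality for symmetric differences. Rational levels then separate unequal values.
  Cutting with \<open>K j\<close> gives the finite measure that \<open>approx\<close> asks
  for.\<close>

lemma superlevel_approximations_determine_AE:
  fixes f g :: "'a \<Rightarrow> real" and K a :: "nat \<Rightarrow> 'a set"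
  assumes [measurable]: "f \<in> borel_measurable M" "g \<in> borel_measurable M"
    and K [measurable]: "\<And>j. K j \<in> sets M" and fin: "\<And>j. emeasure M (K j) < \<infinity>" and UN: "(\<Union>j. K j) = space M"
    and a [measurable]: "\<And>k. a k \<in> sets M"
    and approx: "\<And>E \<epsilon>. E \<in> sets M \<Longrightarrow> emeasure M E < \<infinity> \<Longrightarrow> (\<epsilon>::real) > 0 \<Longrightarrow>
      \<exists>k. emeasure M (sym_diff E (a k)) < ennreal \<epsilon>"
    and same: "\<And>r j k l. emeasure M (sym_diff ({x \<in> space M. f x > of_rat r} \<inter> K j) (a k)) < ennreal (1 / Suc l) \<longleftrightarrow>
      emeasure M (sym_diff ({x \<in> space M. g x > of_rat r} \<inter> K j) (a k)) < ennreal (1 / Suc l)"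
  shows "AE x in M. f x = g x"
proof -
  have "AE x in M. x \<in> K j \<longrightarrow> (f x > of_rat r \<longleftrightarrow> g x > of_rat r)" for r j
  proof -
    let ?X = "{x \<in> space M. f x > of_rat r} \<inter> K j" and ?Y = "{x \<in> space M. g x > of_rat r} \<inter> K j"
    \<comment> \<open>The summand 0 gives the form expected by
      \<open>ennreal_le_epsilon\<close>.\<close>
    have "emeasure M (sym_diff ?X ?Y) \<le> 0 + ennreal e" if "e > 0" for e
    proof -
      obtain l where l: "1 / Suc l < e / 2" using \<open>e > 0\<close> nat_approx_posE[of "e / 2"] by auto
      have "emeasure M ?X \<le> emeasure M (K j)" by (intro emeasure_mono) auto
      with fin[of j] have "emeasure M ?X < \<infinity>" by (rule order.strict_trans1[rotated])
      then obtain k where k: "emeasure M (sym_diff ?X (a k)) < ennreal (1 / Suc l)"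
        using approx[of ?X "1 / Suc l"] by auto
      have "emeasure M (sym_diff ?X ?Y) \<le> emeasure M (sym_diff ?X (a k) \<union> sym_diff ?Y (a k))"
        by (intro emeasure_mono) auto
      also have "\<dots> \<le> emeasure M (sym_diff ?X (a k)) + emeasure M (sym_diff ?Y (a k))"
        by (intro emeasure_subadditive) auto
      \<comment> \<open>By \<open>same\<close>, the set \<open>a k\<close> chosen for
        \<open>?X\<close> is within the same tolerance of \<open>?Y\<close>.\<close>
      also have "\<dots> \<le> ennreal (1 / Suc l) + ennreal (1 / Suc l)"
        using k k[unfolded same] by (intro add_mono less_imp_le)
      also have "\<dots> = ennreal (1 / Suc l + 1 / Suc l)"
        by (rule ennreal_plus[symmetric]) auto
      also have "\<dots> \<le> ennreal e" using l by (intro ennreal_leI) linarith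
      finally show ?thesis by simp
    qed
    then have "emeasure M (sym_diff ?X ?Y) \<le> 0" by (rule ennreal_le_epsilon)
    then have "AE x in M. x \<notin> sym_diff ?X ?Y"
      by (intro AE_not_in) (auto simp: null_sets_def)
    with AE_space show ?thesis by eventually_elim auto
  qed
  then have "AE x in M. \<forall>r j. x \<in> K j \<longrightarrow> (f x > of_rat r \<longleftrightarrow> g x > of_rat r)"
    unfolding AE_all_countable by blast
  with AE_space show ?thesis
  proof eventually_elim
    case (elim x)
    then obtain j where "x \<in> K j" using UN by auto
    with elim have *: "f x > of_rat r \<longleftrightarrow> g x > of_rat r" for r by blast
    show ?case
    proof (rule ccontr)
      assume "f x \<noteq> g x"
      then consider "f x < g x" | "g x < f x" by linarith
      then show False
        using * of_rat_dense[of "f x" "g x"] of_rat_dense[of "g x" "f x"] by cases (meson less_asym)+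
    qed
  qed
qed

lemma sets_countable_lepoll_reals: "(UNIV :: 'b::countable set set) \<lesssim> (UNIV :: real set)"
proof -
  have "inj (\<lambda>A :: 'b set. to_nat ` A)" by (simp add: inj_image_eq_iff inj_def)
  then have "(UNIV :: 'b set set) \<lesssim> (UNIV :: nat set set)"
    unfolding lepoll_def by blast
  also have "\<dots> \<approx> (UNIV :: real set)" by (rule nat_sets_eqpoll_reals)
  finally show ?thesis .
qed

text \<open>This is separability of the sets of finite measure under the pseudometric given by the
  measure of the symmetric difference.\<close>

definition separable_measure :: "'a measure \<Rightarrow> bool" where
  "separable_measure M \<longleftrightarrow> (\<exists>A1. A1 \<subseteq> sets M \<and> countable A1 \<and>
      (\<forall>E\<in>sets M. emeasure M E < \<infinity> \<longrightarrow>
        (\<forall>\<epsilon>::real. \<epsilon> > 0 \<longrightarrow> (\<exists>E0\<in>A1. emeasure M (sym_diff E E0) < ennreal \<epsilon>))))"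

text \<open>The guard \<open>u \<in> carrier (L0 M)\<close> keeps the chosen function measurable
  even when \<open>u\<close> is not a class.\<close>

definition L0_rep :: "'a measure \<Rightarrow> ('a \<Rightarrow> real) set \<Rightarrow> 'a \<Rightarrow> real" where
  "L0_rep M u = (SOME f. f \<in> borel_measurable M \<and> (u \<in> carrier (L0 M) \<longrightarrow> ae_class M f = u))"

lemma L0_rep:
  shows L0_rep_measurable: "L0_rep M u \<in> borel_measurable M"
    and ae_class_L0_rep: "u \<in> carrier (L0 M) \<Longrightarrow> ae_class M (L0_rep M u) = u"
proof -
  have "\<exists>f. f \<in> borel_measurable M \<and> (u \<in> carrier (L0 M) \<longrightarrow> ae_class M f = u)"
    by (cases "u \<in> carrier (L0 M)") (auto simp: carrier_L0 intro: borel_measurable_const)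
  from someI_ex[OF this] show "L0_rep M u \<in> borel_measurable M"
    and "u \<in> carrier (L0 M) \<Longrightarrow> ae_class M (L0_rep M u) = u"
    unfolding L0_rep_def by blast+
qed

text \<open>Provides enough real indices for all pairs of a sequence \<open>u\<close> and a length
  \<open>m\<close> of an initial segment. The approximation bits \<open>E\<close> determine each
  term of \<open>u\<close>, so a pair is coded by a subset of a countable type.\<close>

lemma L0_seq_times_nat_lepoll_reals:
  assumes "sigma_finite_measure M" "separable_measure M"
  shows "carrier (L0_seq M) \<times> (UNIV :: nat set) \<lesssim> (UNIV :: real set)"
proof -
  obtain K :: "nat \<Rightarrow> 'a set" where K: "\<And>j. K j \<in> sets M" "\<And>j. emeasure M (K j) < \<infinity>"
      "(\<Union>j. K j) = space M"
    using sigma_finite_measure.sigma_finite[OF assms(1)]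
    by (metis infinity_ennreal_def less_top range_subsetD)
  obtain A1 where A1: "A1 \<subseteq> sets M" "countable A1"
      "\<And>E \<epsilon>. E \<in> sets M \<Longrightarrow> emeasure M E < \<infinity> \<Longrightarrow> (\<epsilon>::real) > 0 \<Longrightarrow>
        \<exists>E0\<in>A1. emeasure M (sym_diff E E0) < ennreal \<epsilon>"
    using assms(2) unfolding separable_measure_def by auto
  have "A1 \<noteq> {}" using A1(3)[of "{}" 1] by auto
  define a where "a = from_nat_into A1"
  have "range a = A1" unfolding a_def using \<open>A1 \<noteq> {}\<close> A1(2) by (rule range_from_nat_into)
  then have a: "\<And>k. a k \<in> sets M"
      "\<And>E \<epsilon>. E \<in> sets M \<Longrightarrow> emeasure M E < \<infinity> \<Longrightarrow> (\<epsilon>::real) > 0 \<Longrightarrow>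
        \<exists>k. emeasure M (sym_diff E (a k)) < ennreal \<epsilon>"
    using A1(1,3) by blast+
  define E where "E u i r j k l \<longleftrightarrow>
      emeasure M (sym_diff ({x \<in> space M. L0_rep M (u i) x > of_rat r} \<inter> K j) (a k)) < ennreal (1 / Suc l)"
    for u :: "nat \<Rightarrow> ('a \<Rightarrow> real) set" and i r j k l
  \<comment> \<open>The right summand stores \<open>m\<close>, the left one the bits of
    \<open>u\<close>.\<close>
  define \<Phi> :: "(nat \<Rightarrow> ('a \<Rightarrow> real) set) \<times> nat \<Rightarrow> (nat \<times> rat \<times> nat \<times> nat \<times> nat + nat) set"
    where "\<Phi> = (\<lambda>(u, m). insert (Inr m) (Inl ` {(i, r, j, k, l). E u i r j k l}))"
  have "inj_on \<Phi> (carrier (L0_seq M) \<times> UNIV)"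
  proof (rule inj_onI, clarify)
    fix u v m n assume u: "u \<in> carrier (L0_seq M)" and v: "v \<in> carrier (L0_seq M)"
      and eq: "\<Phi> (u, m) = \<Phi> (v, n)"
    have "Inr m \<in> \<Phi> (v, n)" unfolding eq[symmetric] by (simp add: \<Phi>_def)
    then have "m = n" by (auto simp: \<Phi>_def)
    have "u i = v i" for i
    proof -
      have same: "E u i r j k l \<longleftrightarrow> E v i r j k l" for r j k l
      proof -
        have "Inl (i, r, j, k, l) \<in> \<Phi> (u, m) \<longleftrightarrow> Inl (i, r, j, k, l) \<in> \<Phi> (v, n)"
          by (simp only: eq)
        then show ?thesis by (simp add: \<Phi>_def image_iff)
      qed
      have "AE x in M. L0_rep M (u i) x = L0_rep M (v i) x"
        by (rule superlevel_approximations_determine_AE[where K = K and a = a, OF L0_rep_measurable L0_rep_measurable K a(1)])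
           (use a(2) same[unfolded E_def] in blast)+
      then have "ae_class M (L0_rep M (u i)) = ae_class M (L0_rep M (v i))"
        by (simp add: ae_class_eq_iff L0_rep_measurable)
      moreover have "u i \<in> carrier (L0 M)" "v i \<in> carrier (L0 M)"
        using u v by (auto simp: L0_seq_def)
      ultimately show ?thesis by (simp add: ae_class_L0_rep)
    qed
    then show "u = v \<and> m = n" using \<open>m = n\<close> by auto
  qed
  then have "carrier (L0_seq M) \<times> (UNIV :: nat set) \<lesssim> (UNIV :: (nat \<times> rat \<times> nat \<times> nat \<times> nat + nat) set set)"
    unfolding lepoll_def by blast
  also have "\<dots> \<lesssim> (UNIV :: real set)" by (rule sets_countable_lepoll_reals)
  finally show ?thesis .
qed

section \<open>Construction of the dense basis\<close>

text \<open>Both properties depend only on the tail, so \<open>f\<close> is prescribed only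
  eventually. The integrals are at most \<open>C powr q\<close> times the measures of the pieces,
  which tend to 0, while convergence to 0 fails at every point of \<open>A\<close>, a set of
  positive measure.\<close>

lemma block_sequence_in:
  fixes P :: "nat \<Rightarrow> nat \<Rightarrow> 'a set" and G :: "nat \<Rightarrow> real"
  assumes f [measurable]: "\<And>n. f n \<in> borel_measurable M"
    and A: "A \<in> fmeasurable M" "measure M A > 0"
    and P: "\<And>k i. P k i \<in> sets M" "\<And>k i. emeasure M (P k i) \<le> ennreal (1 / Suc k)"
      "\<And>k. finite {i. P k i \<noteq> {}}" "\<And>k. (\<Union>i. P k i) = A"
    and ev: "\<forall>\<^sub>F n in sequentially. \<forall>x. f n x = G (fst (prod_decode n)) * indicator (case_prod P (prod_decode n)) x"
    and C: "\<And>k. \<bar>G k\<bar> \<le> C"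
    and c: "\<exists>\<^sub>\<infinity>k. G k = c" "c \<noteq> 0"
  shows "(\<lambda>n. ae_class M (f n)) \<in> (\<Inter>q\<in>{0<..}. S_L M q) - S_p M"
proof -
  define B where "B n = case_prod P (prod_decode n)" for n
  have [measurable]: "B n \<in> sets M" for n using P(1) by (simp add: B_def split: prod.split)
  have ev': "\<forall>\<^sub>F n in sequentially. \<forall>x. f n x = G (fst (prod_decode n)) * indicator (B n) x"
    using ev by (simp add: B_def)
  have "(\<lambda>n. ae_class M (f n)) \<in> S_L M q" if "q > 0" for q
    unfolding in_S_L_iff[OF f]
  proof (rule tendsto_sandwich[OF _ _ tendsto_const])
    show "\<forall>\<^sub>F n in sequentially. 0 \<le> (\<integral>\<^sup>+x. ennreal (\<bar>f n x\<bar> powr q) \<partial>M)" by simp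
    show "\<forall>\<^sub>F n in sequentially. (\<integral>\<^sup>+x. ennreal (\<bar>f n x\<bar> powr q) \<partial>M) \<le> ennreal (C powr q) * emeasure M (B n)"
      using ev'
    proof eventually_elim
      case (elim n)
      have "ennreal (\<bar>f n x\<bar> powr q) \<le> ennreal (C powr q) * indicator (B n) x" for x
        using C[of "fst (prod_decode n)"] \<open>q > 0\<close>
        by (cases "x \<in> B n") (auto simp: elim[rule_format, of x] intro!: ennreal_leI powr_mono2)
      then have "(\<integral>\<^sup>+x. ennreal (\<bar>f n x\<bar> powr q) \<partial>M) \<le> (\<integral>\<^sup>+x. ennreal (C powr q) * indicator (B n) x \<partial>M)"
        by (intro nn_integral_mono)
      also have "\<dots> = ennreal (C powr q) * emeasure M (B n)"
        by (rule nn_integral_cmult_indicator) simp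
      finally show ?case .
    qed
    have "(\<lambda>n. emeasure M (B n)) \<longlonglongrightarrow> 0"
      unfolding B_def using P(2,3) by (rule small_pieces_tendsto_0)
    then have "(\<lambda>n. ennreal (C powr q) * emeasure M (B n)) \<longlonglongrightarrow> ennreal (C powr q) * 0"
      by (intro ennreal_tendsto_cmult) auto
    then show "(\<lambda>n. ennreal (C powr q) * emeasure M (B n)) \<longlonglongrightarrow> 0" by simp
  qed
  moreover have "(\<lambda>n. ae_class M (f n)) \<notin> S_p M"
    unfolding in_S_p_iff[OF f]
  proof
    assume "AE x in M. (\<lambda>n. f n x) \<longlonglongrightarrow> 0"
    moreover have "x \<notin> A" if lim: "(\<lambda>n. f n x) \<longlonglongrightarrow> 0" for x
    proof
      assume "x \<in> A"
      have "\<forall>\<^sub>F n in sequentially. f n x = G (fst (prod_decode n)) * indicator (case_prod P (prod_decode n)) x"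
        using ev by eventually_elim blast
      from tendsto_cong[OF this] lim blocks_not_tendsto_0[OF c, where x = x and P = P] P(4) \<open>x \<in> A\<close>
      show False by simp
    qed
    ultimately have "AE x in M. x \<notin> A" by (auto elim: eventually_mono)
    then have "A \<in> null_sets M" using A(1) by (simp add: AE_iff_null_sets)
    with A(2) show False by (simp add: measure_def null_sets_def)
  qed
  ultimately show ?thesis by auto
qed

lemma exists_fmeasurable_pos:
  assumes "emeasure M (space M) > 0" "sigma_finite_measure M"
  obtains A where "A \<in> fmeasurable M" "measure M A > 0"
proof -
  obtain K :: "nat \<Rightarrow> 'a set" where K: "range K \<subseteq> sets M" "(\<Union>j. K j) = space M" "\<And>j. emeasure M (K j) \<noteq> \<infinity>"
    using sigma_finite_measure.sigma_finite[OF assms(2)] by metis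
  have "\<exists>j. emeasure M (K j) \<noteq> 0"
    using emeasure_UN_eq_0[of M K] K(1,2) assms(1) by force
  then obtain j where "emeasure M (K j) \<noteq> 0" by blast
  moreover have "K j \<in> fmeasurable M"
    using K(1) K(3)[of j] by (auto simp: fmeasurable_def less_top)
  ultimately show thesis using that[of "K j"] by (auto simp: emeasure_eq_measure2 zero_less_measure_iff)
qed

lemma Lq_not_pointwise_dense_lineable:
  assumes "emeasure M (space M) > 0" "sigma_finite_measure M" "nonatomic M" "separable_measure M"
  shows "continuum_dense_lineable (L0_seq M) (L0_seq_topology M) ((\<Inter>q\<in>{0<..}. S_L M q) - S_p M)"
proof -
  obtain A where A: "A \<in> fmeasurable M" "measure M A > 0"
    using exists_fmeasurable_pos[OF assms(1,2)] .
  obtain P :: "nat \<Rightarrow> nat \<Rightarrow> 'a set" where P: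
    "\<And>k i. P k i \<in> sets M" "\<And>k i. emeasure M (P k i) \<le> ennreal (1 / Suc k)"
    "\<And>k. finite {i. P k i \<noteq> {}}" "\<And>k. (\<Union>i. P k i) = A"
    using nonatomic_small_pieces[OF assms(3) A(1)] by blast
  define B where "B n = case_prod P (prod_decode n)" for n
  have [measurable]: "B n \<in> sets M" for n using P(1) by (simp add: B_def split: prod.split)
  \<comment> \<open>\<open>h\<close> covers all pairs but may take further values outside the
    carrier; \<open>L0_rep\<close> is measurable there too.\<close>
  obtain h :: "real \<Rightarrow> (nat \<Rightarrow> ('a \<Rightarrow> real) set) \<times> nat" where h: "carrier (L0_seq M) \<times> UNIV \<subseteq> range h"
    using L0_seq_times_nat_lepoll_reals[OF assms(2,4)] by (auto simp: lepoll_iff)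
  \<comment> \<open>The head makes the family dense, and the tail decides membership of its
    combinations.\<close>
  define F where "F t n = (if n < snd (h t) then L0_rep M (fst (h t) n)
      else (\<lambda>x. floor_branch t (fst (prod_decode n)) * indicator (B n) x))" for t n
  have F [measurable]: "F t n \<in> borel_measurable M" for t n
    by (simp add: F_def L0_rep_measurable)
  let ?b = "\<lambda>t n. ae_class M (F t n)"
  show ?thesis
  proof (rule continuum_dense_lineableI[where b = ?b])
    show "vectorspace class_ring (L0_seq M)" by (rule vectorspace_L0_seq)
    show "topspace (L0_seq_topology M) = carrier (L0_seq M)" by (rule topspace_L0_seq_topology)
    show b: "?b t \<in> carrier (L0_seq M)" for t by (auto simp: L0_seq_simps)
    have "(\<lambda>n. ae_class M (\<lambda>x. 0)) \<in> S_p M" by (subst in_S_p_iff) auto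
    then show "\<zero>\<^bsub>L0_seq M\<^esub> \<notin> (\<Inter>q\<in>{0<..}. S_L M q) - S_p M" by (simp add: L0_seq_simps)
    show "L0_seq_topology M closure_of (range ?b) = topspace (L0_seq_topology M)"
    proof (rule L0_seq_dense)
      show "range ?b \<subseteq> carrier (L0_seq M)" using b by blast
      fix u m assume u: "u \<in> carrier (L0_seq M)"
      with h have "(u, m) \<in> range h" by auto
      then obtain t where t: "(u, m) = h t" by (rule imageE)
      have "u n \<in> carrier (L0 M)" for n using u by (simp add: L0_seq_def)
      then have "\<forall>n<m. ?b t n = u n" by (simp add: F_def t[symmetric] ae_class_L0_rep)
      then show "\<exists>v\<in>range ?b. \<forall>n<m. v n = u n" by (intro bexI[of _ "?b t"] rangeI)
    qed
    fix S and c :: "real \<Rightarrow> real" and t assume S: "finite S" "t \<in> S" "c t \<noteq> 0"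
    let ?G = "\<lambda>k. \<Sum>s\<in>S. c s * floor_branch s k"
    have "(\<lambda>n. ae_class M (\<lambda>x. \<Sum>s\<in>S. c s * F s n x)) \<in> (\<Inter>q\<in>{0<..}. S_L M q) - S_p M"
    proof (rule block_sequence_in[OF _ A P])
      \<comment> \<open>Past the longest of the finitely many heads, every summand is a typewriter
        term on the same piece \<open>B n\<close>, which factors out.\<close>
      have "\<forall>\<^sub>F n in sequentially. \<forall>s\<in>S. snd (h s) \<le> n"
        using S(1) by (intro eventually_ball_finite) (auto intro: eventually_ge_at_top)
      then show "\<forall>\<^sub>F n in sequentially. \<forall>x. (\<Sum>s\<in>S. c s * F s n x) =
          ?G (fst (prod_decode n)) * indicator (case_prod P (prod_decode n)) x"
        by eventually_elim (auto simp: F_def B_def sum_distrib_right mult.assoc intro!: sum.cong)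
      show "\<bar>?G k\<bar> \<le> (\<Sum>s\<in>S. \<bar>c s\<bar>)" for k
        using floor_branch_range
        by (intro order_trans[OF sum_abs] sum_mono) (simp add: abs_mult mult_left_le)
      \<comment> \<open>At infinitely many \<open>k\<close> only the weight of \<open>t\<close>
        survives, leaving the nonzero coefficient \<open>c t\<close>.\<close>
      have "\<exists>\<^sub>\<infinity>k. \<forall>s\<in>S. floor_branch s k = of_bool (s = t)"
        using S(1) by (rule floor_branch_separate)
      then show "\<exists>\<^sub>\<infinity>k. ?G k = c t"
      proof (rule INFM_mono)
        fix k assume "\<forall>s\<in>S. floor_branch s k = of_bool (s = t)"
        then have "?G k = (\<Sum>s\<in>S. if s = t then c s else 0)" by (intro sum.cong) auto
        also have "\<dots> = c t" using S by simp
        finally show "?G k = c t" .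
      qed
    qed (use S in auto)
    then show "(\<Oplus>\<^bsub>L0_seq M\<^esub>s\<in>S. c s \<odot>\<^bsub>L0_seq M\<^esub> ?b s) \<in> (\<Inter>q\<in>{0<..}. S_L M q) - S_p M"
      using S(1) by (simp only: L0_seq_finsum[OF F])
  qed
qed

theorem theorem3p2:
  fixes M :: "'a measure"
  assumes "emeasure M (space M) > 0"
    and "sigma_finite_measure M"
    and "nonatomic M"
    and "\<exists>A1. A1 \<subseteq> sets M \<and> countable A1 \<and>
      (\<forall>E\<in>sets M. emeasure M E < \<infinity> \<longrightarrow>
        (\<forall>\<epsilon>::real. \<epsilon> > 0 \<longrightarrow> (\<exists>E0\<in>A1. emeasure M (sym_diff E E0) < ennreal \<epsilon>)))"
  shows "continuum_dense_lineable (L0_seq M) (L0_seq_topology M) ((\<Inter>q\<in>{0<..}. S_L M q) - S_p M) \<and>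
    continuum_dense_lineable (L0_seq M) (L0_seq_topology M) (S_m M - S_p M) \<and>
    continuum_dense_lineable (L0_seq M) (L0_seq_topology M) (S_m M - S_c M) \<and>
    continuum_dense_lineable (L0_seq M) (L0_seq_topology M) (S_m M - S_au M) \<and>
    continuum_dense_lineable (L0_seq M) (L0_seq_topology M) (S_m M - S_u M)"
proof -
  have main: "continuum_dense_lineable (L0_seq M) (L0_seq_topology M) ((\<Inter>q\<in>{0<..}. S_L M q) - S_p M)"
    using assms(1-3) assms(4)[folded separable_measure_def] by (rule Lq_not_pointwise_dense_lineable)
  \<comment> \<open>The single exponent 1 already gives convergence in measure.\<close>
  have "(\<Inter>q\<in>{0<..}. S_L M q) \<subseteq> S_m M"
    using S_L_subset_S_m[of 1 M] by (auto simp: INT_iff)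
  \<comment> \<open>The other removed sets all lie inside \<open>S_p M\<close>, so their differences
    contain the one already treated.\<close>
  then have "(\<Inter>q\<in>{0<..}. S_L M q) - S_p M \<subseteq> S_m M - T" if "T \<subseteq> S_p M" for T
    using that by blast
  from continuum_dense_lineable_mono[OF main this] main show ?thesis
    using S_u_subset_S_au[of M] S_au_subset_S_p[of M] S_c_subset_S_p[of M] by auto
qed

end
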